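(* Let $0\le\gamma<\tilde\gamma<1$ and let $H\ge 1$ be an integer. Set $$\alpha_n=\frac{(1-\tilde\gamma)(\tilde\gamma-\gamma)^{n-1}}{(1-\gamma)^n},\qquad n\ge 1.$$ Then for every state $\mathbf{s}_t$ the value function $V(\mathbf{s}_t;\tilde\gamma)$ decomposes as a weighted combination of $H$ $\gamma$-model steps and a terminal value: $$V(\mathbf{s}_t;\tilde\gamma)=\frac{1}{1-\tilde\gamma}\sum_{n=1}^{H}\alpha_n\,\mathbb{E}_{\mathbf{s}_e\sim\mu_n(\cdot\mid\mathbf{s}_t;\gamma)}\big[r(\mathbf{s}_e)\big]+\left(\frac{\tilde\gamma-\gamma}{1-\gamma}\right)^{H}\mathbb{E}_{\mathbf{s}_e\sim\mu_H(\cdot\mid\mathbf{s}_t;\gamma)}\big[V(\mathbf{s}_e;\tilde\gamma)\big].$$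
   Context: Setting: a Markov decision process with state space $\mathcal{S}$, action space $\mathcal{A}$, transition distribution $p(\mathbf{s}_{t+1}\mid \mathbf{s}_t,\mathbf{a}_t)$ and reward function $r:\mathcal{S}\to\mathbb{R}$, together with a fixed policy $\pi(\mathbf{a}\mid\mathbf{s})$. Discounted occupancy: for a discount $\gamma\in[0,1)$, $$\mu(\mathbf{s}\mid \mathbf{s}_t,\mathbf{a}_t;\gamma)=(1-\gamma)\sum_{\Delta t=1}^{\infty}\gamma^{\Delta t-1}\,p(\mathbf{s}_{t+\Delta t}=\mathbf{s}\mid \mathbf{s}_t,\mathbf{a}_t,\pi),$$ where $p(\mathbf{s}_{t+\Delta t}=\cdot\mid \mathbf{s}_t,\mathbf{a}_t,\pi)$ is the law (or density) of the state $\Delta t$ steps later when the first action is $\mathbf{a}_t$ and all later actions are drawn from $\pi$. The state-conditioned occupancy is $\mu(\mathbf{s}\mid\mathbf{s}_t;\gamma)=\mathbb{E}_{\mathbf{a}_t\sim\pi(\cdot\mid\mathbf{s}_t)}[\mu(\mathbf{s}\mid\mathbf{s}_t,\mathbf{a}_t;\gamma)]$. $\gamma$-model rollout: a $\gamma$-model with discount $\gamma$ samples from $\mu(\cdot\mid\mathbf{s};\gamma)$; a rollout conditions each step on the output of the previous step. Thus $\mu_1(\cdot\mid\mathbf{s}_t;\gamma)=\mu(\cdot\mid\mathbf{s}_t;\gamma)$ and, for $n\ge 2$, $\mu_n(\cdot\mid\mathbf{s}_t;\gamma)=\mathbb{E}_{\mathbf{s}'\sim\mu_{n-1}(\cdot\mid\mathbf{s}_t;\gamma)}[\mu(\cdot\mid\mathbf{s}';\gamma)]$.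 Value function: for a discount $\tilde\gamma$, $$V(\mathbf{s}_t;\tilde\gamma)=\sum_{\Delta t=1}^{\infty}\tilde\gamma^{\Delta t-1}\,\mathbb{E}_\pi[r(\mathbf{s}_{t+\Delta t})\mid\mathbf{s}_t]=\frac{1}{1-\tilde\gamma}\,\mathbb{E}_{\mathbf{s}_e\sim\mu(\cdot\mid\mathbf{s}_t;\tilde\gamma)}[r(\mathbf{s}_e)]$$ (rewards are collected at the states following $\mathbf{s}_t$). It is assumed that $V$ is well defined, i.e. $\mathbb{E}_{\mathbf{s}_e\sim\mu(\cdot\mid\mathbf{s};\tilde\gamma)}[|r(\mathbf{s}_e)|]<\infty$ for every state $\mathbf{s}$ (e.g. $r$ bounded). *)

theory Defs
  imports "HOL-Probability.Probability"
begin

text \<open>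
  States form a measurable space \<open>S\<close>, actions a measurable space \<open>A\<close>.  The transition kernel is
  \<open>p :: 's \<Rightarrow> 'a \<Rightarrow> 's measure\<close> and the policy is \<open>\<pi> :: 's \<Rightarrow> 'a measure\<close>; conditional
  laws are represented as measures and kernels are composed with the Giry-monad bind.
\<close>

text \<open>
  \<open>state_law S p \<pi> k s a\<close> is the law of the state \<open>k\<close> steps after \<open>s\<close> when the first action
  is \<open>a\<close> and all later actions are drawn from \<open>\<pi>\<close>.
\<close>

fun state_law ::
  "'s measure \<Rightarrow> ('s \<Rightarrow> 'a \<Rightarrow> 's measure) \<Rightarrow> ('s \<Rightarrow> 'a measure) \<Rightarrow> nat \<Rightarrow> 's \<Rightarrow> 'a \<Rightarrow> 's measure"
where
  "state_law S p \<pi> 0 s a = return S s"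
| "state_law S p \<pi> (Suc 0) s a = p s a"
| "state_law S p \<pi> (Suc (Suc k)) s a =
     state_law S p \<pi> (Suc k) s a \<bind> (\<lambda>s'. \<pi> s' \<bind> (\<lambda>a'. p s' a'))"

definition policy_state_law ::
  "'s measure \<Rightarrow> ('s \<Rightarrow> 'a \<Rightarrow> 's measure) \<Rightarrow> ('s \<Rightarrow> 'a measure) \<Rightarrow> nat \<Rightarrow> 's \<Rightarrow> 's measure"
where
  "policy_state_law S p \<pi> k s = \<pi> s \<bind> (\<lambda>a. state_law S p \<pi> k s a)"

text \<open>The summation index \<open>k\<close> below stands for \<open>\<Delta>t - 1\<close>.\<close>

definition occupancy_sa ::
  "'s measure \<Rightarrow> ('s \<Rightarrow> 'a \<Rightarrow> 's measure) \<Rightarrow> ('s \<Rightarrow> 'a measure) \<Rightarrow> real \<Rightarrow> 's \<Rightarrow> 'a \<Rightarrow> 's measure"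
where
  "occupancy_sa S p \<pi> \<gamma> s a =
     measure_of (space S) (sets S)
       (\<lambda>B. ennreal (1 - \<gamma>) *
          (\<Sum>k. ennreal (\<gamma> ^ k) * emeasure (state_law S p \<pi> (Suc k) s a) B))"

definition occupancy ::
  "'s measure \<Rightarrow> ('s \<Rightarrow> 'a \<Rightarrow> 's measure) \<Rightarrow> ('s \<Rightarrow> 'a measure) \<Rightarrow> real \<Rightarrow> 's \<Rightarrow> 's measure"
where
  "occupancy S p \<pi> \<gamma> s = \<pi> s \<bind> (\<lambda>a. occupancy_sa S p \<pi> \<gamma> s a)"

text \<open>The value at \<open>n = 0\<close> is the natural convention; only \<open>n \<ge> 1\<close> is of interest.\<close>

fun rollout ::
  "'s measure \<Rightarrow> ('s \<Rightarrow> 'a \<Rightarrow> 's measure) \<Rightarrow> ('s \<Rightarrow> 'a measure) \<Rightarrow> real \<Rightarrow> nat \<Rightarrow> 's \<Rightarrow> 's measure"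
where
  "rollout S p \<pi> \<gamma> 0 s = return S s"
| "rollout S p \<pi> \<gamma> (Suc 0) s = occupancy S p \<pi> \<gamma> s"
| "rollout S p \<pi> \<gamma> (Suc (Suc n)) s =
     rollout S p \<pi> \<gamma> (Suc n) s \<bind> (\<lambda>s'. occupancy S p \<pi> \<gamma> s')"

text \<open>Rewards are collected at the states following \<open>s\<close>, not at \<open>s\<close> itself.\<close>

definition value_fn ::
  "'s measure \<Rightarrow> ('s \<Rightarrow> 'a \<Rightarrow> 's measure) \<Rightarrow> ('s \<Rightarrow> 'a measure) \<Rightarrow> ('s \<Rightarrow> real) \<Rightarrow> real \<Rightarrow> 's \<Rightarrow> real"
where
  "value_fn S p \<pi> r \<gamma> s =
     (\<Sum>k. \<gamma> ^ k * (\<integral>s'. r s' \<partial>policy_state_law S p \<pi> (Suc k) s))"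

definition rollout_weight :: "real \<Rightarrow> real \<Rightarrow> nat \<Rightarrow> real" where
  "rollout_weight \<gamma> \<gamma>' n = (1 - \<gamma>') * (\<gamma>' - \<gamma>) ^ (n - 1) / (1 - \<gamma>) ^ n"

text \<open>
  \<open>measure_of\<close> silently yields the null measure when its set function is not a measure;
  the following facts show that this does not happen in \<open>occupancy_sa\<close>.
\<close>

lemma sets_occupancy_sa [simp]: "sets (occupancy_sa S p \<pi> \<gamma> s a) = sets S"
  by (simp add: occupancy_sa_def sets.sigma_sets_eq)

lemma space_occupancy_sa [simp]: "space (occupancy_sa S p \<pi> \<gamma> s a) = space S"
  by (simp add: occupancy_sa_def)

lemma step_kernel:
  assumes "(\<lambda>(s, a). p s a) \<in> S \<Otimes>\<^sub>M A \<rightarrow>\<^sub>M prob_algebra S"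
    and "\<pi> \<in> S \<rightarrow>\<^sub>M prob_algebra A"
  shows "(\<lambda>s'. \<pi> s' \<bind> (\<lambda>a'. p s' a')) \<in> S \<rightarrow>\<^sub>M prob_algebra S"
  using assms by (intro measurable_bind_prob_space2) auto

lemma state_law_kernel:
  assumes p: "(\<lambda>(s, a). p s a) \<in> S \<Otimes>\<^sub>M A \<rightarrow>\<^sub>M prob_algebra S"
    and pol: "\<pi> \<in> S \<rightarrow>\<^sub>M prob_algebra A"
  shows "(\<lambda>(s, a). state_law S p \<pi> (Suc k) s a) \<in> S \<Otimes>\<^sub>M A \<rightarrow>\<^sub>M prob_algebra S"
proof (induction k)
  case 0
  show ?case using p by simp
next
  case (Suc k)
  then show ?case
    using measurable_bind_prob_space[OF Suc step_kernel[OF p pol]]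
    by (simp add: case_prod_unfold)
qed

lemma emeasure_occupancy_sa:
  assumes p: "(\<lambda>(s, a). p s a) \<in> S \<Otimes>\<^sub>M A \<rightarrow>\<^sub>M prob_algebra S"
    and pol: "\<pi> \<in> S \<rightarrow>\<^sub>M prob_algebra A"
    and sa: "s \<in> space S" "a \<in> space A" and B: "B \<in> sets S"
  shows "emeasure (occupancy_sa S p \<pi> \<gamma> s a) B =
    ennreal (1 - \<gamma>) * (\<Sum>k. ennreal (\<gamma> ^ k) * emeasure (state_law S p \<pi> (Suc k) s a) B)"
proof -
  let ?L = "\<lambda>k. state_law S p \<pi> (Suc k) s a"
  have sets_L: "sets (?L k) = sets S" for k
    using measurable_space[OF state_law_kernel[OF p pol, of k], of "(s, a)"] sa
    by (auto simp: space_pair_measure space_prob_algebra)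
  show ?thesis
  proof (rule emeasure_measure_of[OF occupancy_sa_def])
    show "sets S \<subseteq> Pow (space S)" by (rule sets.space_closed)
    show "B \<in> sets (occupancy_sa S p \<pi> \<gamma> s a)" using B by simp
    show "positive (sets (occupancy_sa S p \<pi> \<gamma> s a))
      (\<lambda>B. ennreal (1 - \<gamma>) * (\<Sum>k. ennreal (\<gamma> ^ k) * emeasure (?L k) B))"
      by (simp add: positive_def)
    show "countably_additive (sets (occupancy_sa S p \<pi> \<gamma> s a))
      (\<lambda>B. ennreal (1 - \<gamma>) * (\<Sum>k. ennreal (\<gamma> ^ k) * emeasure (?L k) B))"
    proof (rule countably_additiveI)
      fix F :: "nat \<Rightarrow> _"
      assume F: "range F \<subseteq> sets (occupancy_sa S p \<pi> \<gamma> s a)" "disjoint_family F"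
      have "(\<Sum>i. ennreal (1 - \<gamma>) * (\<Sum>k. ennreal (\<gamma> ^ k) * emeasure (?L k) (F i)))
          = ennreal (1 - \<gamma>) * (\<Sum>i k. ennreal (\<gamma> ^ k) * emeasure (?L k) (F i))"
        by (rule ennreal_suminf_cmult)
      also have "(\<Sum>i k. ennreal (\<gamma> ^ k) * emeasure (?L k) (F i))
          = (\<Sum>k i. ennreal (\<gamma> ^ k) * emeasure (?L k) (F i))"
        by (subst (2 3) nn_integral_count_space_nat[symmetric])
          (simp add: nn_integral_suminf del: ennreal_suminf_cmult)
      also have "\<dots> = (\<Sum>k. ennreal (\<gamma> ^ k) * emeasure (?L k) (\<Union>i. F i))"
        using F by (simp del: state_law.simps
            add: ennreal_suminf_cmult suminf_emeasure[of F] sets_L)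
      finally show "(\<Sum>i. ennreal (1 - \<gamma>) * (\<Sum>k. ennreal (\<gamma> ^ k) * emeasure (?L k) (F i)))
          = ennreal (1 - \<gamma>) * (\<Sum>k. ennreal (\<gamma> ^ k) * emeasure (?L k) (\<Union>i. F i))" .
    qed
  qed
qed

end

theory Submission imports Defs begin

text \<open>
  Write \<open>P\<^sub>k\<close> for the \<open>k\<close>-step kernel of the chain induced by \<open>\<pi>\<close> and
  \<open>W\<^sub>c = (\<Sum>k. c ^ k * P\<^sub>k\<^sub>+\<^sub>1)\<close>.  Then the occupancy for discount \<open>c\<close> is
  \<open>(1 - c) * W\<^sub>c\<close>, the value function is \<open>W\<^sub>c r\<close>, and the semigroup law gives the resolvent
  identity \<open>W\<^sub>c\<^sub>' = W\<^sub>c + (c' - c) * W\<^sub>c W\<^sub>c\<^sub>'\<close>.  Iterating it \<open>H\<close> times on the rightmost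
  factor is the claimed expansion.  Everything is done for nonnegative extended integrals first,
  where no convergence question arises; finiteness of \<open>W\<^sub>c\<^sub>' \<bar>r\<bar>\<close> then forces all other terms to
  be finite.
\<close>

section \<open>Rearranging double series and splitting signed integrands\<close>

text \<open>Shifting row \<open>j\<close> to the right by \<open>j\<close> and padding with zeros
  turns the diagonal \<open>j + k = m\<close> into column \<open>m\<close>. The order of summation
  may then be swapped by Tonelli, read for the counting measure.\<close>

lemma suminf_ennreal_triangle:
  fixes a :: "nat \<Rightarrow> nat \<Rightarrow> ennreal"
  shows "(\<Sum>j k. a j k) = (\<Sum>m. \<Sum>j\<le>m. a j (m - j))"
proof -
  have "(\<Sum>k. a j k) = (\<Sum>m. if j \<le> m then a j (m - j) else 0)" for j
    by (subst suminf_offset[where i = j and f = "\<lambda>m. if j \<le> m then a j (m - j) else 0"]) auto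
  then have "(\<Sum>j k. a j k) = (\<Sum>j m. if j \<le> m then a j (m - j) else 0)"
    by simp
  also have "\<dots> = (\<Sum>m j. if j \<le> m then a j (m - j) else 0)"
    by (subst (2 3) nn_integral_count_space_nat[symmetric]) (simp add: nn_integral_suminf)
  also have "\<dots> = (\<Sum>m. \<Sum>j\<le>m. a j (m - j))"
  proof (rule suminf_cong)
    fix m
    have "(\<Sum>j. if j \<le> m then a j (m - j) else 0) = (\<Sum>j\<le>m. if j \<le> m then a j (m - j) else 0)"
      by (rule suminf_finite) auto
    then show "(\<Sum>j. if j \<le> m then a j (m - j) else 0) = (\<Sum>j\<le>m. a j (m - j))"
      by simp
  qed
  finally show ?thesis .
qed

lemma integral_max_diff:
  fixes f :: "'b \<Rightarrow> real"
  assumes "integrable M f"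
  shows "(\<integral>x. f x \<partial>M) = (\<integral>x. max 0 (f x) \<partial>M) - (\<integral>x. max 0 (- f x) \<partial>M)"
proof -
  have "(\<integral>x. f x \<partial>M) = (\<integral>x. max 0 (f x) - max 0 (- f x) \<partial>M)"
    by (rule Bochner_Integration.integral_cong) auto
  also have "\<dots> = (\<integral>x. max 0 (f x) \<partial>M) - (\<integral>x. max 0 (- f x) \<partial>M)"
    using assms by (intro Bochner_Integration.integral_diff integrable_max) auto
  finally show ?thesis .
qed

section \<open>The Markov chain induced by the policy and its semigroup law\<close>

locale mdp =
  fixes S :: "'s measure" and A :: "'a measure"
    and p :: "'s \<Rightarrow> 'a \<Rightarrow> 's measure" and \<pi> :: "'s \<Rightarrow> 'a measure"
  assumes p: "(\<lambda>(s, a). p s a) \<in> S \<Otimes>\<^sub>M A \<rightarrow>\<^sub>M prob_algebra S"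
    and policy: "\<pi> \<in> S \<rightarrow>\<^sub>M prob_algebra A"
begin

text \<open>The shift follows the summation index of \<open>value_fn\<close>. Thus
  \<open>law 0\<close> is the one-step kernel, and composing \<open>law j\<close> with
  \<open>law k\<close> makes \<open>j + k + 2\<close> steps.\<close>

abbreviation law :: "nat \<Rightarrow> 's \<Rightarrow> 's measure" where
  "law k \<equiv> policy_state_law S p \<pi> (Suc k)"

text \<open>The unnormalised operator behind both occupancy and value. Taking values in
  \<open>ennreal\<close> makes the series meaningful before any integrability is known.\<close>

definition resolvent :: "real \<Rightarrow> ('s \<Rightarrow> ennreal) \<Rightarrow> 's \<Rightarrow> ennreal" where
  "resolvent c f s = (\<Sum>k. ennreal (c ^ k) * (\<integral>\<^sup>+x. f x \<partial>law k s))"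

lemma sets_kernel:
  assumes "K \<in> S \<rightarrow>\<^sub>M prob_algebra M" "s \<in> space S"
  shows "sets (K s) = sets M"
  using measurable_space[OF assms] by (simp add: space_prob_algebra)

lemma space_kernel:
  assumes "K \<in> S \<rightarrow>\<^sub>M prob_algebra M" "s \<in> space S"
  shows "space (K s) = space M"
  using sets_kernel[OF assms] by (rule sets_eq_imp_space_eq)

lemma measurable_kernel:
  assumes "K \<in> S \<rightarrow>\<^sub>M prob_algebra M" "s \<in> space S" "f \<in> M \<rightarrow>\<^sub>M N"
  shows "f \<in> K s \<rightarrow>\<^sub>M N"
  using assms(3) sets_kernel[OF assms(1,2)] by (simp cong: measurable_cong_sets)

lemma law_kernel: "law k \<in> S \<rightarrow>\<^sub>M prob_algebra S"
  unfolding policy_state_law_def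
  by (rule measurable_bind_prob_space2[OF policy state_law_kernel[OF p policy]])

lemma state_law_kernel_action:
  assumes "s \<in> space S"
  shows "state_law S p \<pi> (Suc k) s \<in> A \<rightarrow>\<^sub>M prob_algebra S"
  using measurable_compose[OF measurable_Pair1'[OF assms] state_law_kernel[OF p policy, of k]]
  by simp

text \<open>\<open>state_law\<close> appends each policy step at the end, so associativity of bind
  lets the average over the first action be taken before or after that step.\<close>

lemma law_Suc:
  assumes s: "s \<in> space S"
  shows "law (Suc k) s = law k s \<bind> law 0"
proof -
  have *: "(\<lambda>s'. \<pi> s' \<bind> p s') = law 0"
    by (simp add: policy_state_law_def fun_eq_iff)
  have "state_law S p \<pi> (Suc k) s \<in> \<pi> s \<rightarrow>\<^sub>M subprob_algebra S"
    using measurable_kernel[OF policy s measurable_prob_algebraD[OF state_law_kernel_action[OF s]]] .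
  then have "law k s \<bind> law 0 = \<pi> s \<bind> (\<lambda>a. state_law S p \<pi> (Suc k) s a \<bind> law 0)"
    unfolding policy_state_law_def[of S p \<pi> "Suc k"]
    by (rule bind_assoc[OF _ measurable_prob_algebraD[OF law_kernel]])
  also have "\<dots> = law (Suc k) s"
    by (simp add: policy_state_law_def[of S p \<pi> "Suc (Suc k)"] *)
  finally show ?thesis by simp
qed

text \<open>Chapman-Kolmogorov, by peeling the last step off the second kernel. The extra
  \<open>Suc\<close> comes from the shifted index of \<open>law\<close>.\<close>

lemma law_add:
  assumes s: "s \<in> space S"
  shows "law j s \<bind> law k = law (Suc (j + k)) s"
proof (induction k)
  case 0
  show ?case using law_Suc[OF s] by simp
next
  case (Suc k)
  have "law j s \<bind> law (Suc k) = law j s \<bind> (\<lambda>x. law k x \<bind> law 0)"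
    by (rule bind_cong) (auto simp: space_kernel[OF law_kernel s] law_Suc)
  also have "\<dots> = (law j s \<bind> law k) \<bind> law 0"
    by (rule bind_assoc[symmetric, OF measurable_kernel[OF law_kernel s]])
      (auto intro!: measurable_prob_algebraD law_kernel)
  finally show ?case using Suc law_Suc[OF s] by simp
qed

section \<open>Integration against kernels and the resolvent identity\<close>

lemma nn_integral_bind_kernel:
  assumes "K \<in> S \<rightarrow>\<^sub>M prob_algebra M" "s \<in> space S" "L \<in> M \<rightarrow>\<^sub>M prob_algebra N"
    and "f \<in> borel_measurable N"
  shows "(\<integral>\<^sup>+x. f x \<partial>(K s \<bind> L)) = (\<integral>\<^sup>+y. \<integral>\<^sup>+x. f x \<partial>L y \<partial>K s)"
  by (rule nn_integral_bind[OF assms(4) measurable_kernel[OF assms(1,2)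
        measurable_prob_algebraD[OF assms(3)]]])

lemma measurable_nn_integral_kernel:
  assumes "K \<in> S \<rightarrow>\<^sub>M prob_algebra S" "f \<in> borel_measurable S"
  shows "(\<lambda>s. \<integral>\<^sup>+x. f x \<partial>K s) \<in> borel_measurable S"
  using assms measurable_prob_algebraD[OF assms(1)]
  by (intro nn_integral_measurable_subprob_algebra2[where N = S]) auto

lemma measurable_resolvent:
  assumes "f \<in> borel_measurable S"
  shows "resolvent c f \<in> borel_measurable S"
  unfolding resolvent_def[abs_def]
  by (intro borel_measurable_suminf_order borel_measurable_times_ennreal borel_measurable_const
      measurable_nn_integral_kernel law_kernel assms)

text \<open>Monotone convergence pulls the inner series out of the integral, the semigroup law
  merges the two kernels, and the terms are collected by the total index
  \<open>m = j + k\<close>.\<close>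

lemma resolvent_resolvent:
  assumes s: "s \<in> space S" and f: "f \<in> borel_measurable S" and c: "0 \<le> c" "0 \<le> c'"
  shows "resolvent c (resolvent c' f) s =
    (\<Sum>m. ennreal (\<Sum>j\<le>m. c ^ j * c' ^ (m - j)) * (\<integral>\<^sup>+x. f x \<partial>law (Suc m) s))"
proof -
  have "ennreal (c ^ j) * (\<integral>\<^sup>+y. resolvent c' f y \<partial>law j s) =
      (\<Sum>k. ennreal (c ^ j * c' ^ k) * (\<integral>\<^sup>+x. f x \<partial>law (Suc (j + k)) s))" for j
  proof -
    have m: "(\<lambda>y. \<integral>\<^sup>+x. f x \<partial>law k y) \<in> borel_measurable (law j s)" for k
      by (rule measurable_kernel[OF law_kernel s measurable_nn_integral_kernel[OF law_kernel f]])
    have "(\<integral>\<^sup>+y. resolvent c' f y \<partial>law j s) =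
        (\<Sum>k. ennreal (c' ^ k) * (\<integral>\<^sup>+y. \<integral>\<^sup>+x. f x \<partial>law k y \<partial>law j s))"
      unfolding resolvent_def using m by (simp add: nn_integral_suminf nn_integral_cmult)
    also have "\<dots> = (\<Sum>k. ennreal (c' ^ k) * (\<integral>\<^sup>+x. f x \<partial>law (Suc (j + k)) s))"
      by (simp add: nn_integral_bind_kernel[OF law_kernel s law_kernel f, symmetric] law_add[OF s])
    finally show ?thesis
      using c by (simp add: ennreal_mult mult.assoc)
  qed
  then have "resolvent c (resolvent c' f) s =
      (\<Sum>j k. ennreal (c ^ j * c' ^ k) * (\<integral>\<^sup>+x. f x \<partial>law (Suc (j + k)) s))"
    by (simp add: resolvent_def[of c])
  also have "\<dots> = (\<Sum>m. \<Sum>j\<le>m. ennreal (c ^ j * c' ^ (m - j)) * (\<integral>\<^sup>+x. f x \<partial>law (Suc m) s))"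
    by (subst suminf_ennreal_triangle) simp
  also have "\<dots> = (\<Sum>m. ennreal (\<Sum>j\<le>m. c ^ j * c' ^ (m - j)) * (\<integral>\<^sup>+x. f x \<partial>law (Suc m) s))"
    using c by (simp add: sum_distrib_right[symmetric] sum_ennreal)
  finally show ?thesis .
qed

text \<open>A comparison of coefficients in front of each \<open>law\<close>, resting on the
  factorisation of \<open>c' ^ Suc m - c ^ Suc m\<close>. The additive form avoids subtraction in
  \<open>ennreal\<close>.\<close>

lemma resolvent_identity:
  assumes s: "s \<in> space S" and f: "f \<in> borel_measurable S" and c: "0 \<le> c" "c \<le> c'"
  shows "resolvent c' f s = resolvent c f s + ennreal (c' - c) * resolvent c (resolvent c' f) s"
proof -
  define q where "q m = (\<integral>\<^sup>+x. f x \<partial>law m s)" for m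
  define b where "b m = (\<Sum>j\<le>m. c ^ j * c' ^ (m - j))" for m
  have b: "0 \<le> b m" for m
    using c by (auto simp: b_def intro!: sum_nonneg)
  have "c ^ Suc m - c' ^ Suc m = (c - c') * b m" for m
    unfolding b_def diff_power_eq_sum lessThan_Suc_atMost ..
  then have b_eq: "c' ^ Suc m = c ^ Suc m + (c' - c) * b m" for m
    by (simp add: algebra_simps)
  \<comment> \<open>The term at index 0 has coefficient 1 for every discount. The remaining terms
    start at \<open>law 1\<close>, just as the composed resolvent does.\<close>
  have split: "resolvent d f s = q 0 + (\<Sum>m. ennreal (d ^ Suc m) * q (Suc m))" for d
    unfolding resolvent_def q_def[symmetric] by (subst suminf_offset[where i = 1]) (auto simp: add.commute)
  have "ennreal (c' ^ Suc m) * q (Suc m) =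
      ennreal (c ^ Suc m) * q (Suc m) + ennreal (c' - c) * (ennreal (b m) * q (Suc m))" for m
    unfolding b_eq using b[of m] c
    by (simp add: ennreal_plus ennreal_mult distrib_right mult.assoc del: power_Suc)
  then have "(\<Sum>m. ennreal (c' ^ Suc m) * q (Suc m)) =
      (\<Sum>m. ennreal (c ^ Suc m) * q (Suc m)) + ennreal (c' - c) * (\<Sum>m. ennreal (b m) * q (Suc m))"
    by (simp add: suminf_add[symmetric] del: power_Suc)
  then show ?thesis
    using c by (simp add: split[of c'] split[of c] resolvent_resolvent[OF s f] b_def q_def add.assoc
        del: power_Suc)
qed

section \<open>Occupancy as the state law at a geometric random time\<close>

text \<open>The geometric distribution gives \<open>k\<close> the mass
  \<open>(1 - c) * c ^ k\<close>, which is the weight in the occupancy. Written as a bind, the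
  occupancy becomes accessible to the measurability and integration rules of the Giry monad.\<close>

lemma occupancy_sa_eq_bind:
  assumes sa: "s \<in> space S" "a \<in> space A" and c: "0 \<le> c" "c < 1"
  shows "occupancy_sa S p \<pi> c s a =
    measure_pmf (geometric_pmf (1 - c)) \<bind> (\<lambda>k. state_law S p \<pi> (Suc k) s a)"
proof -
  have L: "(\<lambda>k. state_law S p \<pi> (Suc k) s a) \<in> measure_pmf (geometric_pmf (1 - c)) \<rightarrow>\<^sub>M subprob_algebra S"
    using measurable_space[OF measurable_prob_algebraD[OF state_law_kernel_action[OF sa(1)]] sa(2)]
    by simp
  show ?thesis
  proof (rule measure_eqI)
    show "sets (occupancy_sa S p \<pi> c s a) =
        sets (measure_pmf (geometric_pmf (1 - c)) \<bind> (\<lambda>k. state_law S p \<pi> (Suc k) s a))"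
      by (simp add: sets_bind_measurable[OF L] del: state_law.simps)
    fix B assume "B \<in> sets (occupancy_sa S p \<pi> c s a)"
    then have B: "B \<in> sets S" by simp
    have "emeasure (measure_pmf (geometric_pmf (1 - c)) \<bind> (\<lambda>k. state_law S p \<pi> (Suc k) s a)) B =
        (\<Sum>k. ennreal (1 - c) * (ennreal (c ^ k) * emeasure (state_law S p \<pi> (Suc k) s a) B))"
      using c by (subst emeasure_bind[OF _ L B])
        (auto simp: nn_integral_measure_pmf nn_integral_count_space_nat ennreal_mult ac_simps
          simp del: state_law.simps ennreal_suminf_cmult)
    then show "emeasure (occupancy_sa S p \<pi> c s a) B =
        emeasure (measure_pmf (geometric_pmf (1 - c)) \<bind> (\<lambda>k. state_law S p \<pi> (Suc k) s a)) B"
      by (simp add: emeasure_occupancy_sa[OF p policy sa B])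
  qed
qed

text \<open>The time index ranges over a countable discrete space, so measurability in state and
  action for each fixed \<open>k\<close> already gives joint measurability. Mixing over
  \<open>k\<close> then preserves it.\<close>

lemma occupancy_sa_kernel:
  assumes c: "0 \<le> c" "c < 1"
  shows "(\<lambda>(s, a). occupancy_sa S p \<pi> c s a) \<in> S \<Otimes>\<^sub>M A \<rightarrow>\<^sub>M prob_algebra S"
proof -
  have "(\<lambda>x. state_law S p \<pi> (Suc k) (fst (fst x)) (snd (fst x))) \<in>
      (S \<Otimes>\<^sub>M A) \<Otimes>\<^sub>M count_space UNIV \<rightarrow>\<^sub>M prob_algebra S" for k :: nat
    using measurable_compose[OF measurable_fst state_law_kernel[OF p policy, of k]]
    by (simp add: case_prod_unfold del: state_law.simps)
  then have "(\<lambda>(sa, k). state_law S p \<pi> (Suc k) (fst sa) (snd sa)) \<in>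
      (S \<Otimes>\<^sub>M A) \<Otimes>\<^sub>M count_space UNIV \<rightarrow>\<^sub>M prob_algebra S"
    unfolding case_prod_unfold by (rule measurable_compose_countable[OF _ measurable_snd])
  then have "(\<lambda>sa. measure_pmf (geometric_pmf (1 - c)) \<bind>
      (\<lambda>k. state_law S p \<pi> (Suc k) (fst sa) (snd sa))) \<in> S \<Otimes>\<^sub>M A \<rightarrow>\<^sub>M prob_algebra S"
    by (intro measurable_bind_prob_space2[where N = "count_space UNIV"])
      (auto simp: space_prob_algebra measure_pmf.prob_space_axioms)
  then show ?thesis
    \<comment> \<open>The geometric representation is known only for points of the product space,
      hence the passage through congruence.\<close>
    by (rule measurable_cong[THEN iffD1, rotated])
      (auto simp: occupancy_sa_eq_bind[OF _ _ c] space_pair_measure)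
qed

lemma occupancy_kernel:
  assumes "0 \<le> c" "c < 1"
  shows "occupancy S p \<pi> c \<in> S \<rightarrow>\<^sub>M prob_algebra S"
  unfolding occupancy_def[abs_def]
  by (rule measurable_bind_prob_space2[OF policy occupancy_sa_kernel[OF assms]])

text \<open>Integrating out the geometric time gives a series for each first action. Averaging over
  that action commutes with the series and turns each \<open>state_law\<close> into
  \<open>law\<close>.\<close>

lemma nn_integral_occupancy:
  assumes s: "s \<in> space S" and f: "f \<in> borel_measurable S" and c: "0 \<le> c" "c < 1"
  shows "(\<integral>\<^sup>+x. f x \<partial>occupancy S p \<pi> c s) = ennreal (1 - c) * resolvent c f s"
proof -
  have sa: "(\<integral>\<^sup>+x. f x \<partial>occupancy_sa S p \<pi> c s a) =
      (\<Sum>k. ennreal (1 - c) * (ennreal (c ^ k) * (\<integral>\<^sup>+x. f x \<partial>state_law S p \<pi> (Suc k) s a)))"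
    if a: "a \<in> space A" for a
  proof -
    have "(\<lambda>k. state_law S p \<pi> (Suc k) s a) \<in> measure_pmf (geometric_pmf (1 - c)) \<rightarrow>\<^sub>M subprob_algebra S"
      using measurable_space[OF measurable_prob_algebraD[OF state_law_kernel_action[OF s]] a] by simp
    then show ?thesis
      using c unfolding occupancy_sa_eq_bind[OF s a c]
      by (subst nn_integral_bind[OF f])
        (auto simp: nn_integral_measure_pmf nn_integral_count_space_nat ennreal_mult ac_simps
          simp del: state_law.simps ennreal_suminf_cmult)
  qed
  have occ: "occupancy_sa S p \<pi> c s \<in> A \<rightarrow>\<^sub>M prob_algebra S"
    using measurable_compose[OF measurable_Pair1'[OF s] occupancy_sa_kernel[OF c]] by simp
  have m: "(\<lambda>a. \<integral>\<^sup>+x. f x \<partial>state_law S p \<pi> (Suc k) s a) \<in> borel_measurable (\<pi> s)" for k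
    using f measurable_prob_algebraD[OF state_law_kernel_action[OF s]]
    by (intro measurable_kernel[OF policy s] nn_integral_measurable_subprob_algebra2[where N = S]) auto
  have "(\<integral>\<^sup>+x. f x \<partial>occupancy S p \<pi> c s) = (\<integral>\<^sup>+a. \<integral>\<^sup>+x. f x \<partial>occupancy_sa S p \<pi> c s a \<partial>\<pi> s)"
    unfolding occupancy_def by (rule nn_integral_bind_kernel[OF policy s occ f])
  also have "\<dots> = (\<integral>\<^sup>+a. (\<Sum>k. ennreal (1 - c) *
      (ennreal (c ^ k) * (\<integral>\<^sup>+x. f x \<partial>state_law S p \<pi> (Suc k) s a))) \<partial>\<pi> s)"
    by (intro nn_integral_cong sa) (simp add: space_kernel[OF policy s])
  also have "\<dots> = (\<Sum>k. ennreal (1 - c) * (ennreal (c ^ k) *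
      (\<integral>\<^sup>+a. \<integral>\<^sup>+x. f x \<partial>state_law S p \<pi> (Suc k) s a \<partial>\<pi> s)))"
    using m by (simp add: nn_integral_suminf nn_integral_cmult del: state_law.simps ennreal_suminf_cmult)
  also have "\<dots> = ennreal (1 - c) * resolvent c f s"
    unfolding resolvent_def policy_state_law_def
    by (simp add: nn_integral_bind_kernel[OF policy s state_law_kernel_action[OF s] f]
        del: state_law.simps)
  finally show ?thesis .
qed

section \<open>Rollouts and the finite expansion in extended nonnegative reals\<close>

lemma rollout_kernel:
  assumes c: "0 \<le> c" "c < 1"
  shows "rollout S p \<pi> c (Suc n) \<in> S \<rightarrow>\<^sub>M prob_algebra S"
proof (induction n)
  case 0
  show ?case using occupancy_kernel[OF c] by (simp cong: measurable_cong)
next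
  case (Suc n)
  show ?case using measurable_bind_prob_space[OF Suc occupancy_kernel[OF c]]
    by (simp cong: measurable_cong)
qed

text \<open>This is \<open>resolvent_identity\<close> with the inner operators replaced by
  normalised occupancies; cancelling \<open>1 - c\<close> produces the two coefficients.\<close>

lemma resolvent_expansion_step:
  assumes s: "s \<in> space S" and f: "f \<in> borel_measurable S"
    and c: "0 \<le> c" "c \<le> c'" "c < 1"
  shows "resolvent c' f s =
    ennreal (1 / (1 - c)) * (\<integral>\<^sup>+x. f x \<partial>occupancy S p \<pi> c s) +
    ennreal ((c' - c) / (1 - c)) * (\<integral>\<^sup>+x. resolvent c' f x \<partial>occupancy S p \<pi> c s)"
proof -
  have "ennreal (1 / (1 - c)) * ennreal (1 - c) = 1"
    "ennreal ((c' - c) / (1 - c)) * ennreal (1 - c) = ennreal (c' - c)"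
    using c by (auto simp: ennreal_mult[symmetric])
  then show ?thesis
    using resolvent_identity[OF s f c(1,2)]
    by (simp add: nn_integral_occupancy[OF s _ c(1,3)] f measurable_resolvent mult.assoc[symmetric])
qed

text \<open>The one-step expansion is inserted into the trailing integral, and each insertion
  lengthens the rollout by one occupancy. Counting from 0, the parameter \<open>H\<close> here
  stands for \<open>H + 1\<close> rollout steps.\<close>

lemma resolvent_expansion:
  assumes s: "s \<in> space S" and f: "f \<in> borel_measurable S"
    and c: "0 \<le> c" "c \<le> c'" "c < 1"
  defines "d \<equiv> (c' - c) / (1 - c)"
  shows "resolvent c' f s =
    (\<Sum>n\<le>H. ennreal (1 / (1 - c) * d ^ n) * (\<integral>\<^sup>+x. f x \<partial>rollout S p \<pi> c (Suc n) s)) +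
    ennreal (d ^ Suc H) * (\<integral>\<^sup>+x. resolvent c' f x \<partial>rollout S p \<pi> c (Suc H) s)"
proof (induction H)
  case 0
  show ?case using resolvent_expansion_step[OF s f c] by (simp add: d_def)
next
  case (Suc H)
  have d: "0 \<le> d" and e: "0 \<le> 1 / (1 - c)" using c by (auto simp: d_def)
  let ?R = "\<lambda>n. rollout S p \<pi> c (Suc n) s" and ?O = "occupancy S p \<pi> c"
  note R = rollout_kernel[OF c(1,3)] and O = occupancy_kernel[OF c(1,3)]
  have bind: "(\<integral>\<^sup>+x. g x \<partial>?R (Suc H)) = (\<integral>\<^sup>+y. \<integral>\<^sup>+x. g x \<partial>?O y \<partial>?R H)"
    if "g \<in> borel_measurable S" for g
    using nn_integral_bind_kernel[OF R s O that] by simp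
  have m: "(\<lambda>y. \<integral>\<^sup>+x. g x \<partial>?O y) \<in> borel_measurable (?R H)"
    if "g \<in> borel_measurable S" for g
    by (rule measurable_kernel[OF R s measurable_nn_integral_kernel[OF O that]])
  have "(\<integral>\<^sup>+x. resolvent c' f x \<partial>?R H) =
      (\<integral>\<^sup>+y. ennreal (1 / (1 - c)) * (\<integral>\<^sup>+x. f x \<partial>?O y) +
        ennreal d * (\<integral>\<^sup>+x. resolvent c' f x \<partial>?O y) \<partial>?R H)"
    unfolding d_def using space_kernel[OF R s, of H]
    by (intro nn_integral_cong resolvent_expansion_step[OF _ f c]) (simp del: rollout.simps)
  also have "\<dots> = ennreal (1 / (1 - c)) * (\<integral>\<^sup>+x. f x \<partial>?R (Suc H)) +
      ennreal d * (\<integral>\<^sup>+x. resolvent c' f x \<partial>?R (Suc H))"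
    using m[OF f] m[OF measurable_resolvent[OF f]]
    by (simp add: nn_integral_add nn_integral_cmult bind[OF f] bind[OF measurable_resolvent[OF f]]
        del: rollout.simps)
  finally have step: "(\<integral>\<^sup>+x. resolvent c' f x \<partial>?R H) = \<dots>" .
  \<comment> \<open>Multiplying by \<open>d ^ Suc H\<close> splits the old remainder into the next
    summand and the new remainder.\<close>
  have "ennreal (d ^ Suc H) * (\<integral>\<^sup>+x. resolvent c' f x \<partial>?R H) =
      ennreal (1 / (1 - c) * d ^ Suc H) * (\<integral>\<^sup>+x. f x \<partial>?R (Suc H)) +
      ennreal (d ^ Suc (Suc H)) * (\<integral>\<^sup>+x. resolvent c' f x \<partial>?R (Suc H))"
    unfolding step power_Suc[of d "Suc H"] ennreal_mult[OF e zero_le_power[OF d]]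
      ennreal_mult[OF d zero_le_power[OF d]]
    by (simp add: distrib_left ac_simps del: rollout.simps power_Suc)
  then show ?case
    using Suc by (simp add: add.assoc del: rollout.simps power_Suc)
qed

section \<open>Nonnegative rewards: from extended to real integrals\<close>

context
  fixes f :: "'s \<Rightarrow> real" and c' :: real
  assumes f: "f \<in> borel_measurable S" and f_nonneg: "\<And>x. 0 \<le> f x"
    and c': "0 < c'" "c' < 1"
    and int: "\<forall>s\<in>space S. integrable (occupancy S p \<pi> c' s) f"
begin

text \<open>The occupancy integral is \<open>1 - c'\<close> times the resolvent, and this factor is
  strictly positive.\<close>

lemma resolvent_finite:
  assumes s: "s \<in> space S"
  shows "resolvent c' f s < \<infinity>"
proof -
  have "(\<integral>\<^sup>+x. ennreal (f x) \<partial>occupancy S p \<pi> c' s) < \<infinity>"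
    using int s f_nonneg by (simp add: integrable_iff_bounded)
  then show ?thesis
    using c' f by (subst (asm) nn_integral_occupancy[OF s]) (auto simp: ennreal_mult_less_top)
qed

text \<open>Every term of a finite nonnegative series is finite, and \<open>0 < c'\<close> allows
  the weight \<open>c' ^ k\<close> to be removed.\<close>

lemma value_fn_summands:
  assumes s: "s \<in> space S"
  shows "integrable (law k s) f"
    and "ennreal (c' ^ k * (\<integral>x. f x \<partial>law k s)) = ennreal (c' ^ k) * (\<integral>\<^sup>+x. f x \<partial>law k s)"
proof -
  have "ennreal (c' ^ k) * (\<integral>\<^sup>+x. f x \<partial>law k s) < \<infinity>"
    using resolvent_finite[OF s] ennreal_suminf_lessD unfolding resolvent_def by auto
  then have "(\<integral>\<^sup>+x. f x \<partial>law k s) < \<infinity>"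
    using c' by (auto simp: ennreal_mult_less_top)
  then show int: "integrable (law k s) f"
    using measurable_kernel[OF law_kernel s f] f_nonneg by (simp add: integrable_iff_bounded)
  show "ennreal (c' ^ k * (\<integral>x. f x \<partial>law k s)) = ennreal (c' ^ k) * (\<integral>\<^sup>+x. f x \<partial>law k s)"
    using nn_integral_eq_integral[OF int] f_nonneg c' by (simp add: ennreal_mult')
qed

text \<open>A real \<open>suminf\<close> is meaningful only for a convergent series; convergence
  follows from finiteness of the extended sum.\<close>

lemma value_fn_summable:
  assumes s: "s \<in> space S"
  shows "summable (\<lambda>k. c' ^ k * (\<integral>x. f x \<partial>law k s))"
  using resolvent_finite[OF s] f_nonneg c'
  by (intro summable_suminf_not_top) (auto simp: value_fn_summands[OF s] resolvent_def)

lemma value_fn_nonneg: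
  assumes "s \<in> space S"
  shows "0 \<le> value_fn S p \<pi> f c' s"
  unfolding value_fn_def using c' f_nonneg value_fn_summable[OF assms] by (intro suminf_nonneg) auto

lemma ennreal_value_fn:
  assumes s: "s \<in> space S"
  shows "ennreal (value_fn S p \<pi> f c' s) = resolvent c' f s"
proof -
  have "resolvent c' f s = (\<Sum>k. ennreal (c' ^ k * (\<integral>x. f x \<partial>law k s)))"
    by (simp add: value_fn_summands[OF s] resolvent_def)
  also have "\<dots> = ennreal (value_fn S p \<pi> f c' s)"
    unfolding value_fn_def using resolvent_finite[OF s] c' f_nonneg
    by (intro suminf_ennreal2 value_fn_summable[OF s]) auto
  finally show ?thesis by simp
qed

text \<open>On \<open>space S\<close> the value function is the real part of a measurable extended
  function; off that space nothing is claimed.\<close>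

lemma measurable_value_fn: "value_fn S p \<pi> f c' \<in> borel_measurable S"
proof -
  have "(\<lambda>s. enn2real (resolvent c' f s)) \<in> borel_measurable S"
    using measurable_resolvent[of f c'] f by simp
  then show ?thesis
    by (rule measurable_cong[THEN iffD1, rotated])
      (simp add: ennreal_value_fn[symmetric] value_fn_nonneg)
qed

text \<open>Strict inequality \<open>c < c'\<close> makes all coefficients positive. Finiteness of
  the left side of the extended expansion thus forces every integral on the right to be finite, and
  the identity descends to the reals.\<close>

lemma value_fn_expansion_nonneg:
  assumes s: "s \<in> space S" and c: "0 \<le> c" "c < c'"
  defines "d \<equiv> (c' - c) / (1 - c)"
  shows "integrable (rollout S p \<pi> c (Suc H) s) f"
    and "integrable (rollout S p \<pi> c (Suc H) s) (value_fn S p \<pi> f c')"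
    and "value_fn S p \<pi> f c' s =
      (\<Sum>n\<le>H. 1 / (1 - c) * d ^ n * (\<integral>x. f x \<partial>rollout S p \<pi> c (Suc n) s)) +
      d ^ Suc H * (\<integral>x. value_fn S p \<pi> f c' x \<partial>rollout S p \<pi> c (Suc H) s)"
proof -
  let ?R = "\<lambda>n. rollout S p \<pi> c (Suc n) s" and ?V = "value_fn S p \<pi> f c'"
  have c1: "c \<le> c'" "c < 1" using c c' by auto
  have d: "0 < d" and e: "0 < 1 / (1 - c)" using c c1 by (auto simp: d_def)
  note R = rollout_kernel[OF c(1) c1(2)]
  have V: "(\<integral>\<^sup>+x. resolvent c' f x \<partial>?R n) = (\<integral>\<^sup>+x. ?V x \<partial>?R n)" for n
    using space_kernel[OF R s] by (intro nn_integral_cong) (simp add: ennreal_value_fn)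
  \<comment> \<open>\<open>H\<close> is generalised here, since integrability is needed for every
    rollout length in the sum.\<close>
  have expansion: "resolvent c' f s =
    (\<Sum>n\<le>H. ennreal (1 / (1 - c) * d ^ n) * (\<integral>\<^sup>+x. f x \<partial>?R n)) +
    ennreal (d ^ Suc H) * (\<integral>\<^sup>+x. ?V x \<partial>?R H)" for H
    using resolvent_expansion[OF s _ c(1) c1, of f H] f unfolding V d_def[symmetric] by simp
  \<comment> \<open>The integral of \<open>f\<close> is read off from the last summand
    \<open>n = H\<close>, that of \<open>?V\<close> from the remainder.\<close>
  have "(\<integral>\<^sup>+x. f x \<partial>?R H) < \<infinity>" and "(\<integral>\<^sup>+x. ?V x \<partial>?R H) < \<infinity>" for H
    using resolvent_finite[OF s] d e unfolding expansion[of H]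
    by (auto simp: ennreal_mult_less_top simp del: power_Suc rollout.simps dest: bspec[of _ _ H])
  moreover have "AE x in ?R H. 0 \<le> ?V x" for H
    using space_kernel[OF R s] by (intro AE_I2) (simp add: value_fn_nonneg)
  ultimately have int_f: "integrable (?R H) f" and int_V: "integrable (?R H) ?V" for H
    using measurable_kernel[OF R s f] measurable_kernel[OF R s measurable_value_fn] f_nonneg
    by (auto intro!: integrableI_nonneg simp del: rollout.simps)
  then show "integrable (?R H) f" "integrable (?R H) ?V" by blast+
  have nn_V: "0 \<le> (\<integral>x. ?V x \<partial>?R H)"
    using space_kernel[OF R s]
    by (intro Bochner_Integration.integral_nonneg_AE AE_I2) (simp add: value_fn_nonneg)
  have eq_V: "(\<integral>\<^sup>+x. ?V x \<partial>?R H) = ennreal (\<integral>x. ?V x \<partial>?R H)"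
    using space_kernel[OF R s]
    by (intro nn_integral_eq_integral int_V AE_I2) (simp add: value_fn_nonneg)
  have eq_f: "(\<integral>\<^sup>+x. f x \<partial>?R n) = ennreal (\<integral>x. f x \<partial>?R n)" for n
    using f_nonneg by (intro nn_integral_eq_integral int_f AE_I2) auto
  have nn_f: "0 \<le> 1 / (1 - c) * d ^ n * (\<integral>x. f x \<partial>?R n)" for n
    using f_nonneg d e by (intro mult_nonneg_nonneg integral_nonneg zero_le_power) auto
  let ?rhs = "(\<Sum>n\<le>H. 1 / (1 - c) * d ^ n * (\<integral>x. f x \<partial>?R n)) + d ^ Suc H * (\<integral>x. ?V x \<partial>?R H)"
  have "ennreal (?V s) = ennreal ?rhs"
    unfolding ennreal_value_fn[OF s] expansion[of H] eq_V eq_f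
    using nn_f nn_V d e
    by (simp add: ennreal_plus sum_nonneg ennreal_mult'[symmetric] del: power_Suc rollout.simps)
  \<comment> \<open>\<open>ennreal\<close> is injective only on nonnegative reals, so both signs
    must be known.\<close>
  moreover have "0 \<le> ?rhs"
    using nn_f nn_V d by (intro add_nonneg_nonneg sum_nonneg) auto
  ultimately show "?V s = ?rhs"
    using value_fn_nonneg[OF s] by simp
qed

end

end

section \<open>Signed rewards\<close>

theorem theorem2:
  fixes S :: "'s measure" and A :: "'a measure"
    and p :: "'s \<Rightarrow> 'a \<Rightarrow> 's measure" and \<pi> :: "'s \<Rightarrow> 'a measure"
    and r :: "'s \<Rightarrow> real" and \<gamma> \<gamma>' :: real and H :: nat and s :: 's
  assumes p: "(\<lambda>(s, a). p s a) \<in> S \<Otimes>\<^sub>M A \<rightarrow>\<^sub>M prob_algebra S"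
    and policy: "\<pi> \<in> S \<rightarrow>\<^sub>M prob_algebra A"
    and r_measurable: "r \<in> borel_measurable S"
    and r_integrable: "\<And>s. s \<in> space S \<Longrightarrow> integrable (occupancy S p \<pi> \<gamma>' s) r"
    and discounts: "0 \<le> \<gamma>" "\<gamma> < \<gamma>'" "\<gamma>' < 1"
    and H: "1 \<le> H"
    and s: "s \<in> space S"
  shows "value_fn S p \<pi> r \<gamma>' s =
    1 / (1 - \<gamma>') * (\<Sum>n = 1..H. rollout_weight \<gamma> \<gamma>' n * (\<integral>s\<^sub>e. r s\<^sub>e \<partial>rollout S p \<pi> \<gamma> n s))
    + ((\<gamma>' - \<gamma>) / (1 - \<gamma>)) ^ H * (\<integral>s\<^sub>e. value_fn S p \<pi> r \<gamma>' s\<^sub>e \<partial>rollout S p \<pi> \<gamma> H s)"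
proof -
  interpret mdp S A p \<pi> by standard (fact p policy)+
  \<comment> \<open>Positive and negative parts of the reward each satisfy the nonnegative case. All
    quantities there are finite, so the two expansions may be subtracted.\<close>
  let ?f = "\<lambda>x. max 0 (r x)" and ?g = "\<lambda>x. max 0 (- r x)"
  let ?V = "\<lambda>f. value_fn S p \<pi> f \<gamma>'"
  let ?R = "\<lambda>n. rollout S p \<pi> \<gamma> (Suc n) s"
  define d where "d = (\<gamma>' - \<gamma>) / (1 - \<gamma>)"
  obtain N where N: "H = Suc N" using H by (cases H) auto
  have \<gamma>': "0 < \<gamma>'" "\<gamma>' < 1" and \<gamma>: "\<gamma> < 1" using discounts by auto
  have f: "?f \<in> borel_measurable S" "\<And>x. 0 \<le> ?f x"
    "\<forall>s\<in>space S. integrable (occupancy S p \<pi> \<gamma>' s) ?f"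
    using r_measurable r_integrable by auto
  have g: "?g \<in> borel_measurable S" "\<And>x. 0 \<le> ?g x"
    "\<forall>s\<in>space S. integrable (occupancy S p \<pi> \<gamma>' s) ?g"
    using r_measurable r_integrable by auto
  note hyps_f = f(1,2) \<gamma>' f(3) and hyps_g = g(1,2) \<gamma>' g(3)
  have integrable_r: "integrable M r" if "integrable M ?f" "integrable M ?g" for M
  proof -
    have "integrable M (\<lambda>x. ?f x - ?g x)"
      using that by (rule Bochner_Integration.integrable_diff)
    moreover have "(\<lambda>x. ?f x - ?g x) = r" by auto
    ultimately show ?thesis by simp
  qed
  \<comment> \<open>Subtracting the two series termwise requires their convergence, which is
    available at states in \<open>space S\<close>.\<close>
  have V: "?V r x = ?V ?f x - ?V ?g x" if x: "x \<in> space S" for x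
  proof -
    have "(\<integral>y. r y \<partial>law k x) = (\<integral>y. ?f y \<partial>law k x) - (\<integral>y. ?g y \<partial>law k x)" for k
      by (intro integral_max_diff integrable_r value_fn_summands(1)[OF hyps_f x]
          value_fn_summands(1)[OF hyps_g x])
    then show ?thesis
      unfolding value_fn_def
      by (simp add: right_diff_distrib suminf_diff[OF value_fn_summable[OF hyps_f x]
            value_fn_summable[OF hyps_g x]])
  qed
  note expansion_f = value_fn_expansion_nonneg[OF hyps_f s discounts(1,2), folded d_def]
    and expansion_g = value_fn_expansion_nonneg[OF hyps_g s discounts(1,2), folded d_def]
  have R: "(\<integral>x. r x \<partial>?R n) = (\<integral>x. ?f x \<partial>?R n) - (\<integral>x. ?g x \<partial>?R n)" for n
    by (intro integral_max_diff integrable_r expansion_f(1) expansion_g(1))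
  have "(\<integral>x. ?V r x \<partial>?R N) = (\<integral>x. ?V ?f x - ?V ?g x \<partial>?R N)"
    using space_kernel[OF rollout_kernel[OF discounts(1) \<gamma>] s]
    by (intro Bochner_Integration.integral_cong) (simp_all add: V)
  also have "\<dots> = (\<integral>x. ?V ?f x \<partial>?R N) - (\<integral>x. ?V ?g x \<partial>?R N)"
    by (intro Bochner_Integration.integral_diff expansion_f(2) expansion_g(2))
  finally have RV: "(\<integral>x. ?V r x \<partial>?R N) = \<dots>" .
  have "?V r s = (\<Sum>n\<le>N. 1 / (1 - \<gamma>) * d ^ n * (\<integral>x. r x \<partial>?R n)) + d ^ H * (\<integral>x. ?V r x \<partial>?R N)"
    unfolding R RV N V[OF s]
    by (subst expansion_f(3)[of N], subst expansion_g(3)[of N])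
      (simp add: right_diff_distrib sum_subtractf diff_divide_distrib del: rollout.simps)
  \<comment> \<open>At \<open>Suc n\<close> the exponent \<open>n - 1\<close> of the weight becomes
    \<open>n\<close>, and the factor \<open>1 - \<gamma>'\<close> cancels, leaving
    \<open>d ^ n / (1 - \<gamma>)\<close>.\<close>
  also have "(\<Sum>n\<le>N. 1 / (1 - \<gamma>) * d ^ n * (\<integral>x. r x \<partial>?R n)) =
      (\<Sum>n\<le>N. 1 / (1 - \<gamma>') * (rollout_weight \<gamma> \<gamma>' (Suc n) * (\<integral>x. r x \<partial>?R n)))"
    using \<gamma>' by (intro sum.cong refl) (simp add: rollout_weight_def d_def power_divide del: rollout.simps)
  also have "\<dots> = 1 / (1 - \<gamma>') * (\<Sum>n = 1..H. rollout_weight \<gamma> \<gamma>' n * (\<integral>x. r x \<partial>rollout S p \<pi> \<gamma> n s))"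
    unfolding N One_nat_def sum.atLeast_Suc_atMost_Suc_shift
    by (simp add: sum_distrib_left atMost_atLeast0 del: rollout.simps)
  finally show ?thesis
    by (simp add: N d_def)
qed

end
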